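(* $C(1,0)=2$, $C(2,0)=0$, $C(2^2,0)=-2$, and $C(2^m,0)=2$ for every integer $m\ge 3$.
   Context: $C(n,x)$ is the minimal polynomial over $\mathbb Q$ of $2\cos(\pi/n)$, $n\in\mathbb N$. *)

theory Defs
  imports Complex_Main "HOL-Computational_Algebra.Computational_Algebra"
begin

(* Junk value of THE for transcendental x; see ex1_min_poly_rat for algebraic x. *)
definition min_poly_rat :: "'a :: field_char_0 \<Rightarrow> rat poly" where
  "min_poly_rat x = (THE p. lead_coeff p = 1 \<and> poly (map_poly of_rat p) x = 0 \<and>
     (\<forall>q. q \<noteq> 0 \<and> poly (map_poly of_rat q) x = 0 \<longrightarrow> degree p \<le> degree q))"

(* Meant for n > 0 only; n = 0 gives the minimal polynomial of 2, since pi / 0 = 0. *)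
definition C :: "nat \<Rightarrow> rat poly" where
  "C n = min_poly_rat (2 * cos (pi / real n))"

lemma ex1_min_poly_rat:
  fixes x :: "'a :: field_char_0"
  assumes "algebraic x"
  shows "\<exists>!p. lead_coeff p = 1 \<and> poly (map_poly of_rat p) x = 0 \<and>
     (\<forall>q. q \<noteq> 0 \<and> poly (map_poly of_rat q) x = 0 \<longrightarrow> degree p \<le> degree q)"
proof -
  let ?R = "\<lambda>q :: rat poly. q \<noteq> 0 \<and> poly (map_poly of_rat q) x = 0"
  have "\<exists>q. ?R q"
  proof -
    obtain p :: "'a poly" where p: "\<And>i. coeff p i \<in> \<int>" "p \<noteq> 0" "poly p x = 0"
      using assms unfolding algebraic_def by blast
    have "\<forall>i. \<exists>k. coeff p i = of_int k"
      using p(1) by (blast elim: Ints_cases)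
    then obtain f where f: "\<And>i. coeff p i = of_int (f i)"
      by (auto dest: choice)
    define q :: "rat poly" where "q = Poly (map (\<lambda>i. of_int (f i)) [0..<Suc (degree p)])"
    have "map_poly of_rat q = p"
    proof (rule poly_eqI)
      fix i
      show "coeff (map_poly of_rat q) i = coeff p i"
        by (cases "i < Suc (degree p)")
           (auto simp: q_def coeff_map_poly nth_default_def coeff_eq_0 f [symmetric]
                 simp del: upt_Suc)
    qed
    then show ?thesis using p by (intro exI [of _ q]) auto
  qed
  then obtain q where q: "?R q" and qmin: "\<And>r. ?R r \<Longrightarrow> degree q \<le> degree r"
    using ex_has_least_nat [of ?R _ degree] by blast
  have map_smult: "map_poly of_rat (smult c r) = smult (of_rat c :: 'a) (map_poly of_rat r)"
    for c r by (rule poly_eqI) (simp add: coeff_map_poly of_rat_mult)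
  have map_diff: "map_poly of_rat (r - s) = (map_poly of_rat r - map_poly of_rat s :: 'a poly)"
    for r s by (rule poly_eqI) (simp add: coeff_map_poly of_rat_diff)
  define p where "p = smult (inverse (lead_coeff q)) q"
  show ?thesis
  proof (rule ex1I [of _ p])
    show "lead_coeff p = 1 \<and> poly (map_poly of_rat p) x = 0 \<and>
        (\<forall>q. ?R q \<longrightarrow> degree p \<le> degree q)"
      using q qmin by (auto simp: p_def map_smult)
  next
    fix r
    assume r: "lead_coeff r = 1 \<and> poly (map_poly of_rat r) x = 0 \<and>
        (\<forall>q. ?R q \<longrightarrow> degree r \<le> degree q)"
    have p: "?R p" "lead_coeff p = 1" "degree p = degree q"
      using q by (auto simp: p_def map_smult)
    have "r \<noteq> 0" using r by auto
    then have deg: "degree r = degree p" using r p(1,3) qmin [of r] by (intro order_antisym) auto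
    show "r = p"
    proof (rule ccontr)
      assume "r \<noteq> p"
      then have "?R (r - p)" using r p by (auto simp: map_diff)
      then have "degree p \<le> degree (r - p)" using qmin [of "r - p"] p(3) by simp
      moreover have "degree (r - p) \<le> degree p"
        using deg degree_diff_le [of r "degree p" p] by simp
      ultimately have "degree (r - p) = degree p" by (rule order_antisym [rotated])
      then have "lead_coeff (r - p) = 0" using r p(2) deg by simp
      then show False using \<open>r \<noteq> p\<close> by (simp only: leading_coeff_0_iff right_minus_eq)
    qed
  qed
qed

lemmas min_poly_rat_props = theI' [OF ex1_min_poly_rat, folded min_poly_rat_def]

end

theory Submission
  imports Defs
begin

text \<open>
  Iterating \<open>X \<mapsto> X\<^sup>2 - 2\<close> doubles the angle in \<open>2 cos t\<close>, so the \<open>k\<close>-th iterate, which has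
  degree \<open>2\<^sup>k\<close>, vanishes at \<open>2 cos (\<pi> / 2\<^bsup>k+1\<^esup>)\<close>.
  Modulo 2 it is \<open>X\<close> to the power \<open>2\<^sup>k\<close>, and for \<open>k \<ge> 1\<close> its
  constant coefficient is \<open>\<plusminus>2\<close>, so it is irreducible by Eisenstein's criterion and Gauss' lemma.
  It is therefore the minimal polynomial, and its constant coefficient is the orbit
  \<open>0, -2, 2, 2, \<dots>\<close> of 0.
\<close>

section \<open>Eisenstein's criterion\<close>

text \<open>In the convolution for coefficient \<open>i\<close> of \<open>f * g\<close>, every term
  except \<open>coeff f i * coeff g 0\<close> contains a lower coefficient of \<open>f\<close>,
  divisible by \<open>p\<close> by strong induction. Primality then removes
  \<open>coeff g 0\<close>.\<close>

lemma prime_elem_dvd_coeffs_of_mult: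
  fixes f g :: "'a :: comm_ring_1 poly"
  assumes p: "prime_elem p" and g: "\<not> p dvd coeff g 0"
    and fg: "\<And>i. i < n \<Longrightarrow> p dvd coeff (f * g) i" and "i < n"
  shows "p dvd coeff f i"
  using \<open>i < n\<close>
proof (induction i rule: less_induct)
  case (less i)
  have "coeff (f * g) i = (\<Sum>j\<le>i. coeff f j * coeff g (i - j))"
    by (rule coeff_mult)
  also have "\<dots> = (\<Sum>j<i. coeff f j * coeff g (i - j)) + coeff f i * coeff g 0"
    by (simp add: lessThan_Suc_atMost [symmetric])
  finally have "coeff f i * coeff g 0 =
      coeff (f * g) i - (\<Sum>j<i. coeff f j * coeff g (i - j))"
    by simp
  moreover have "p dvd (\<Sum>j<i. coeff f j * coeff g (i - j))"
    using less by (intro dvd_sum) auto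
  ultimately have "p dvd coeff f i * coeff g 0"
    using fg [OF less.prems] by simp
  then show ?case
    using p g by (simp add: prime_elem_dvd_mult_iff)
qed

text \<open>Since \<open>p ^ 2\<close> does not divide the constant coefficient, one factor has
  constant coefficient prime to \<open>p\<close>; that factor must be constant. The conclusion
  speaks of degrees because a constant factor need not be a unit over a domain.\<close>

theorem eisenstein_criterion:
  fixes f g :: "'a :: idom poly"
  assumes p: "prime_elem p" and lead: "\<not> p dvd lead_coeff (f * g)"
    and fg: "\<And>i. i < degree (f * g) \<Longrightarrow> p dvd coeff (f * g) i"
    and sq: "\<not> p ^ 2 dvd coeff (f * g) 0"
  shows "degree f = 0 \<or> degree g = 0"
proof -
  have nz: "f \<noteq> 0" "g \<noteq> 0"
    using lead by auto
  \<comment> \<open>Stated for fresh \<open>f\<close> and \<open>g\<close>, so that it serves for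
    both orders of the factors.\<close>
  have const: "degree g = 0"
    if "\<not> p dvd coeff g 0" "\<not> p dvd lead_coeff (f * g)" "f \<noteq> 0" "g \<noteq> 0"
       "\<And>i. i < degree (f * g) \<Longrightarrow> p dvd coeff (f * g) i" for f g :: "'a poly"
  proof (rule ccontr)
    assume "degree g \<noteq> 0"
    have "p dvd lead_coeff f"
    proof (rule prime_elem_dvd_coeffs_of_mult [OF p that(1)])
      \<comment> \<open>A nonconstant \<open>g\<close> puts the index of the leading coefficient of
        \<open>f\<close> in the range where the product is divisible by \<open>p\<close>.\<close>
      show "degree f < degree (f * g)"
        using that(3,4) \<open>degree g \<noteq> 0\<close> by (simp add: degree_mult_eq)
    qed (rule that(5))
    with that(2) show False
      unfolding lead_coeff_mult by (meson dvd_mult2)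
  qed
  have "\<not> p dvd coeff f 0 \<or> \<not> p dvd coeff g 0"
    using sq mult_dvd_mono [of p "coeff f 0" p "coeff g 0"]
    unfolding coeff_mult_0 power2_eq_square by blast
  then show ?thesis
  proof
    assume "\<not> p dvd coeff f 0"
    then have "degree f = 0"
      by (rule const [OF _ _ nz(2,1)]) (use lead fg in \<open>simp_all only: mult.commute [of g f] not_False_eq_True\<close>)
    then show ?thesis ..
  next
    assume "\<not> p dvd coeff g 0"
    then have "degree g = 0"
      by (rule const [OF _ lead nz fg])
    then show ?thesis ..
  qed
qed

section \<open>Minimal polynomials from integer polynomials\<close>

lemma map_poly_of_int_mult:
  "map_poly of_int (p * q) = (map_poly of_int p * map_poly of_int q :: 'a :: comm_ring_1 poly)"
  by (rule poly_eqI) (simp add: coeff_map_poly coeff_mult)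

lemma map_poly_of_int_smult:
  "map_poly of_int (smult c p) = smult (of_int c :: 'a :: comm_ring_1) (map_poly of_int p)"
  by (rule poly_eqI) (simp add: coeff_map_poly)

lemma map_poly_of_int_diff:
  "map_poly of_int (p - q) = (map_poly of_int p - map_poly of_int q :: 'a :: comm_ring_1 poly)"
  by (rule poly_eqI) (simp add: coeff_map_poly)

lemma map_poly_of_rat_of_int:
  "map_poly of_rat (map_poly of_int p) = (map_poly of_int p :: 'a :: field_char_0 poly)"
  by (rule poly_eqI) (simp add: coeff_map_poly)

lemma rat_poly_clear_denominators:
  fixes q :: "rat poly"
  obtains c r where "c \<noteq> 0" "smult (of_int c) q = map_poly of_int r"
proof -
  have "\<exists>c r. c \<noteq> 0 \<and> smult (of_int c) q = map_poly of_int r"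
  proof (induction q)
    case 0
    show ?case by (intro exI [of _ 1] exI [of _ 0]) simp
  next
    case (pCons a q)
    then obtain c r where c: "c \<noteq> 0" "smult (of_int c) q = map_poly of_int r"
      by blast
    obtain n d where nd: "quotient_of a = (n, d)"
      by (cases "quotient_of a")
    have d: "d > 0" "of_int d * a = of_int n"
      using quotient_of_denom_pos [OF nd] quotient_of_div [OF nd] by auto
    have "smult (of_int (c * d)) (pCons a q) =
        pCons (of_int c * (of_int d * a)) (smult (of_int d) (smult (of_int c) q))"
      by (simp add: mult_ac)
    also have "\<dots> = map_poly of_int (pCons (c * n) (smult d r))"
      by (simp add: d(2) c(2) map_poly_pCons map_poly_of_int_smult)
    finally show ?case
      using c(1) d(1) by (intro exI [of _ "c * d"]) auto
  qed
  then show ?thesis using that by blast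
qed

text \<open>
  The hypothesis \<open>no_factor\<close> is irreducibility over the integers; Gauss' lemma enters
  through the multiplicativity of \<^const>\<open>primitive_part\<close>.
\<close>

lemma degree_le_if_common_root:
  fixes f r :: "int poly" and x :: "'a :: field_char_0"
  assumes monic: "lead_coeff f = 1" and root: "poly (map_poly of_int f) x = 0"
    and no_factor: "\<And>g h. f = g * h \<Longrightarrow> degree g = 0 \<or> degree h = 0"
    and "r \<noteq> 0" and "poly (map_poly of_int r) x = 0"
  shows "degree f \<le> degree r"
proof -
  let ?R = "\<lambda>r :: int poly. r \<noteq> 0 \<and> poly (map_poly of_int r) x = 0"
  \<comment> \<open>Least degree makes the pseudo-remainder of \<open>f\<close> by \<open>r'\<close>
    vanish, because it also has the root \<open>x\<close>. Pseudo-division stays over the integers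
    at the price of the factor \<open>a\<close>.\<close>
  obtain r' where r': "?R r'" and least: "\<And>s. ?R s \<Longrightarrow> degree r' \<le> degree s"
    using ex_has_least_nat [of ?R r degree] assms(4,5) by blast
  obtain a g where a: "a \<noteq> 0" and eq: "smult a f = r' * g + pseudo_mod f r'"
    using pseudo_mod(1) [of r' f] r' by auto
  have "pseudo_mod f r' = smult a f - r' * g"
    using eq by simp
  then have "poly (map_poly of_int (pseudo_mod f r')) x = 0"
    using r' root by (simp add: map_poly_of_int_diff map_poly_of_int_smult map_poly_of_int_mult)
  then have "pseudo_mod f r' = 0"
    using least [of "pseudo_mod f r'"] pseudo_mod(2) [of r' f] r' by fastforce
  with eq have eq: "smult a f = r' * g"
    by simp
  have "content f dvd 1"
    using content_dvd_coeff [of f "degree f"] monic by simp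
  then have "primitive_part f = f"
    by (intro primitive_part_prim) (simp only: is_unit_content_iff)
  then have "smult (unit_factor a) f = primitive_part r' * primitive_part g"
    using arg_cong [OF eq, of primitive_part] by (simp add: primitive_part_smult primitive_part_mult)
  \<comment> \<open>Primitive parts have reduced \<open>a\<close> to its sign; a second sign cancels
    it and leaves a factorization of \<open>f\<close> itself.\<close>
  then have "smult (sgn a * sgn a) f = primitive_part r' * smult (sgn a) (primitive_part g)"
    by (metis mult_smult_right smult_smult unit_factor_int_def)
  moreover have "sgn a * sgn a = 1"
    using a by (simp add: sgn_if)
  ultimately have "degree r' = 0 \<or> degree g = 0"
    using no_factor [of "primitive_part r'" "smult (sgn a) (primitive_part g)"] a
    by (auto simp: sgn_eq_0_iff)
  \<comment> \<open>A nonzero constant has no root, so it is \<open>g\<close> that is constant, and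
    \<open>f\<close> has the degree of \<open>r'\<close>.\<close>
  moreover have "degree r' \<noteq> 0"
  proof
    assume "degree r' = 0"
    then obtain c where "r' = [:c:]"
      by (elim degree_eq_zeroE)
    with r' show False
      by (simp add: map_poly_pCons)
  qed
  moreover have "f \<noteq> 0"
    using monic by auto
  then have "g \<noteq> 0"
    using eq a by auto
  then have "degree f = degree r' + degree g"
    using arg_cong [OF eq, of degree] a r' by (simp add: degree_mult_eq)
  ultimately show ?thesis
    using least [of r] assms(4,5) by auto
qed

text \<open>Clearing denominators changes neither the degree nor the root, so the bound against
  integer polynomials extends to rational ones. Uniqueness then evaluates the description.\<close>

lemma min_poly_rat_eqI:
  fixes f :: "int poly" and x :: "'a :: field_char_0"
  assumes monic: "lead_coeff f = 1" and root: "poly (map_poly of_int f) x = 0"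
    and no_factor: "\<And>g h. f = g * h \<Longrightarrow> degree g = 0 \<or> degree h = 0"
  shows "min_poly_rat x = map_poly of_int f"
proof -
  have "f \<noteq> 0"
    using monic by auto
  have alg: "algebraic x"
    by (rule algebraicI [of "map_poly of_int f"])
       (use root \<open>f \<noteq> 0\<close> in \<open>auto simp: coeff_map_poly map_poly_eq_0_iff\<close>)
  have deg: "degree (map_poly of_int s :: 'b :: field_char_0 poly) = degree s" for s
    by (rule degree_map_poly) simp
  have "degree f \<le> degree q"
    if q: "q \<noteq> 0" "poly (map_poly of_rat q) x = 0" for q
  proof -
    obtain c r where c: "c \<noteq> 0" "smult (of_int c) q = map_poly of_int r"
      by (rule rat_poly_clear_denominators)
    have "map_poly of_int r = (map_poly of_rat (smult (of_int c) q) :: 'a poly)"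
      by (simp add: c(2) map_poly_of_rat_of_int)
    also have "\<dots> = smult (of_int c) (map_poly of_rat q)"
      by (simp add: map_poly_smult of_rat_mult)
    finally have "poly (map_poly of_int r) x = 0"
      using q(2) by simp
    moreover have "r \<noteq> 0"
      using c q(1) by auto
    ultimately have "degree f \<le> degree r"
      using degree_le_if_common_root [OF monic root no_factor] by blast
    also have "degree r = degree q"
      using arg_cong [OF c(2), of degree] c(1) by (simp add: deg)
    finally show ?thesis .
  qed
  then have "lead_coeff (map_poly of_int f :: rat poly) = 1 \<and>
      poly (map_poly of_rat (map_poly of_int f)) x = 0 \<and>
      (\<forall>q. q \<noteq> 0 \<and> poly (map_poly of_rat q) x = 0 \<longrightarrow> degree (map_poly of_int f :: rat poly) \<le> degree q)"
    using monic root by (simp add: deg coeff_map_poly map_poly_of_rat_of_int)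
  then show ?thesis
    unfolding min_poly_rat_def by (intro the1_equality ex1_min_poly_rat [OF alg])
qed

section \<open>The polynomials of angle doubling\<close>

text \<open>This is the rescaled Chebyshev polynomial \<open>2 T_n(X/2)\<close> with
  \<open>n = 2 ^ k\<close>. Integer coefficients allow reduction modulo 2.\<close>

definition doubling_poly :: "nat \<Rightarrow> int poly" where
  "doubling_poly k = ((\<lambda>f. f ^ 2 - 2) ^^ k) [:0, 1:]"

lemma doubling_poly_0 [simp]: "doubling_poly 0 = [:0, 1:]"
  and doubling_poly_Suc [simp]: "doubling_poly (Suc k) = doubling_poly k ^ 2 - 2"
  by (simp_all add: doubling_poly_def)

lemma poly_doubling_poly_2_cos:
  "poly (map_poly of_int (doubling_poly k)) (2 * cos t) = 2 * cos (2 ^ k * t :: real)"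
proof (induction k)
  case 0
  show ?case by (simp add: map_poly_pCons)
next
  case (Suc k)
  have two: "map_poly of_int (2 :: int poly) = (2 :: real poly)"
    by (simp add: numeral_poly map_poly_pCons)
  have "2 * cos (2 ^ Suc k * t) = (2 * cos (2 ^ k * t)) ^ 2 - 2"
    using cos_double_cos [of "2 ^ k * t"] by (simp add: mult_ac power2_eq_square)
  then show ?case
    using Suc by (simp add: map_poly_of_int_diff map_poly_of_int_mult power2_eq_square two)
qed

lemma degree_doubling_poly: "degree (doubling_poly k) = 2 ^ k"
  and lead_coeff_doubling_poly: "lead_coeff (doubling_poly k) = 1"
proof -
  have "degree (doubling_poly k) = 2 ^ k \<and> lead_coeff (doubling_poly k) = 1"
  proof (induction k)
    case (Suc k)
    have "doubling_poly k \<noteq> 0"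
      using Suc by auto
    then have "degree (doubling_poly k ^ 2) = 2 ^ Suc k"
      using Suc by (simp add: degree_power_eq)
    moreover have "lead_coeff (doubling_poly k ^ 2) = 1"
      by (simp only: lead_coeff_power conjunct2 [OF Suc] power_one)
    moreover have "degree (doubling_poly k ^ 2 - 2) = degree (doubling_poly k ^ 2)"
      using calculation(1) degree_add_eq_left [of "- 2" "doubling_poly k ^ 2"] by simp
    ultimately show ?case
      by (simp add: numeral_poly coeff_pCons split: nat.split)
  qed simp
  then show "degree (doubling_poly k) = 2 ^ k" "lead_coeff (doubling_poly k) = 1"
    by auto
qed

text \<open>Modulo 2 squaring is additive and the subtracted 2 disappears, so each step only squares
  the monomial.\<close>

lemma doubling_poly_mod_2: "\<exists>h. doubling_poly k = monom 1 (2 ^ k) + 2 * h"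
proof (induction k)
  case 0
  show ?case by (intro exI [of _ 0]) (simp add: monom_altdef)
next
  case (Suc k)
  then obtain h where h: "doubling_poly k = monom 1 (2 ^ k) + 2 * h" ..
  have "monom 1 (2 ^ k) ^ 2 = (monom 1 (2 ^ Suc k) :: int poly)"
    by (simp add: monom_power mult.commute)
  then have "doubling_poly (Suc k) =
      monom 1 (2 ^ Suc k) + 2 * (2 * monom 1 (2 ^ k) * h + 2 * h ^ 2 - 1)"
    by (simp add: h power2_eq_square algebra_simps)
  then show ?case ..
qed

text \<open>The constant coefficient evolves by \<open>c \<mapsto> c^2 - 2\<close>, which takes 0 to
  -2 and -2 to its fixed point 2.\<close>

lemma coeff_doubling_poly_0:
  "coeff (doubling_poly 1) 0 = -2" "coeff (doubling_poly (Suc (Suc k))) 0 = 2"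
proof -
  show "coeff (doubling_poly 1) 0 = -2"
    by (simp add: power2_eq_square numeral_poly)
  show "coeff (doubling_poly (Suc (Suc k))) 0 = 2"
    by (induction k) (simp_all add: power2_eq_square coeff_mult numeral_poly)
qed

text \<open>The shift in the exponent arises because \<open>k\<close> doublings take
  \<open>pi / 2 ^ Suc k\<close> to \<open>pi / 2\<close>, a zero of the cosine.\<close>

lemma C_power_2: "C (2 ^ Suc k) = map_poly of_int (doubling_poly k)"
  unfolding C_def
proof (rule min_poly_rat_eqI)
  show "lead_coeff (doubling_poly k) = 1"
    by (rule lead_coeff_doubling_poly)
  show "poly (map_poly of_int (doubling_poly k)) (2 * cos (pi / real (2 ^ Suc k))) = 0"
    by (simp add: poly_doubling_poly_2_cos)
next
  fix g h
  assume gh: "doubling_poly k = g * h"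
  show "degree g = 0 \<or> degree h = 0"
  proof (cases k)
    \<comment> \<open>Eisenstein fails for \<open>X\<close>, whose constant coefficient 0 is
      divisible by 4; degree one settles this case.\<close>
    case 0
    have "g \<noteq> 0" "h \<noteq> 0"
      using gh lead_coeff_doubling_poly [of k] by auto
    moreover have "degree (g * h) = 1"
      by (simp add: gh [symmetric] 0)
    ultimately have "degree g + degree h = 1"
      by (simp add: degree_mult_eq)
    then show ?thesis by auto
  next
    case (Suc j)
    show ?thesis
    proof (rule eisenstein_criterion)
      show "prime_elem (2 :: int)"
        by (simp add: prime_imp_prime_elem)
      show "\<not> 2 dvd lead_coeff (g * h)"
        by (simp add: gh [symmetric] lead_coeff_doubling_poly)
      show "2 dvd coeff (g * h) i" if "i < degree (g * h)" for i
      proof -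
        have "i < 2 ^ k"
          using that by (simp add: gh [symmetric] degree_doubling_poly)
        moreover obtain u where "g * h = monom 1 (2 ^ k) + 2 * u"
          using doubling_poly_mod_2 gh by metis
        ultimately show ?thesis
          by (simp add: numeral_poly)
      qed
      have "coeff (doubling_poly k) 0 = 2 \<or> coeff (doubling_poly k) 0 = -2"
        using Suc coeff_doubling_poly_0 by (cases j) auto
      then show "\<not> 2 ^ 2 dvd coeff (g * h) 0"
        by (auto simp: gh)
    qed
  qed
qed

text \<open>The exponent 0 is outside the range of \<open>C_power_2\<close>; here
  \<open>2 * cos pi = -2\<close> is the root of a linear polynomial.\<close>

lemma C_1: "C 1 = [:2, 1:]"
proof -
  have "min_poly_rat (2 * cos (pi / real 1)) = map_poly of_int [:2, 1:]"
  proof (rule min_poly_rat_eqI)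
    fix g h :: "int poly"
    assume gh: "[:2, 1:] = g * h"
    then have "g \<noteq> 0" "h \<noteq> 0"
      by auto
    then have "degree g + degree h = 1"
      using arg_cong [OF gh, of degree] by (simp add: degree_mult_eq)
    then show "degree g = 0 \<or> degree h = 0"
      by auto
  qed (simp_all add: map_poly_pCons)
  then show ?thesis
    by (simp add: C_def map_poly_pCons)
qed

theorem corollary2:
  shows "poly (C 1) 0 = 2 \<and> poly (C 2) 0 = 0 \<and> poly (C (2 ^ 2)) 0 = -2 \<and>
    (\<forall>m::nat. m \<ge> 3 \<longrightarrow> poly (C (2 ^ m)) 0 = 2)"
proof -
  have C0: "poly (C (2 ^ Suc k)) 0 = of_int (coeff (doubling_poly k) 0)" for k
    by (simp only: C_power_2 poly_0_coeff_0) (simp add: coeff_map_poly)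
  have "poly (C (2 ^ m)) 0 = 2" if "m \<ge> 3" for m
  proof -
    \<comment> \<open>\<open>C (2 ^ m)\<close> belongs to iterate \<open>m - 1\<close>, which is at
      least the second exactly when \<open>m \<ge> 3\<close>.\<close>
    have "m = Suc (Suc (Suc (m - 3)))"
      using that by simp
    then obtain k where "m = Suc (Suc (Suc k))" ..
    then show ?thesis
      using C0 [of "Suc (Suc k)"] coeff_doubling_poly_0(2) by (simp del: doubling_poly_Suc)
  qed
  moreover have "poly (C 2) 0 = 0"
    using C0 [of 0] by simp
  moreover have "poly (C (2 ^ 2)) 0 = -2"
    using C0 [of 1] coeff_doubling_poly_0(1) by (simp add: numeral_2_eq_2 del: doubling_poly_Suc)
  moreover have "poly (C 1) 0 = 2"
    by (simp only: C_1) simp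
  ultimately show ?thesis
    by blast
qed

end
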